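(* Let $f:X\to2^X$ be a multivalued map on a compact totally disconnected Hausdorff space $X$. Then $f$ has the shadowing property if and only if $(X,f)$ is conjugate to the inverse limit of an inverse system $\{g^\eta_\lambda,(V_\lambda,f_\lambda)\}_{\lambda\in\Lambda}$ of multivalued systems of finite type such that the induced inverse system of orbit systems $\{(g^\eta_\lambda)^*,\mathrm{Orb}_{f_\lambda}(V_\lambda)\}_{\lambda\in\Lambda}$ satisfies the Mittag-Leffler condition.
   Context: $2^X$ is the set of non-empty closed subsets of $X$. A multivalued map is an upper semicontinuous $f:X\to2^X$ (for every $x$ and open $U\supset f(x)$ there is an open neighborhood $V$ of $x$ with $f(y)\subset U$ for all $y\in V$); $(X,f)$ is then a multivalued system. $\omega=\{0,1,2,\dots\}$. $\mathrm{Orb}_f(X)=\{(x_i)_{i\in\omega}\in X^\omega:x_{i+1}\in f(x_i)\ \forall i\}$ with the product topology; its elements are $f$-orbits. $(X,f)$, $(Y,g)$ are conjugate if there is a homeomorphism $\pi:X\to Y$ with $f(x)=\pi^{-1}(g(\pi(x)))$ for all $x$. Shadowing property (compact Hausdorff case): for a finite open cover $\mathcal V$ of $X$, a $\mathcal V$-pseudo-orbit is a sequence $(x_i)_{i\in\omega}$ such that for each $i$ there is $V_{i+1}\in\mathcal V$ with $f(x_i)\cap V_{i+1}\ne\emptyset$ and $x_{i+1}\in V_{i+1}$; an $f$-orbit $(z_i)$ $\mathcal U$-shadows $(x_i)$ if for each $i$ there is $U_i\in\mathcal U$ with $x_i,z_i\in U_i$. $f$ has the shadowing property if for every finite open cover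 $\mathcal U$ of $X$ there is a finite open cover $\mathcal V$ of $X$ such that every $\mathcal V$-pseudo-orbit is $\mathcal U$-shadowed by some $f$-orbit. A multivalued system of finite type is $(V,f)$ with $V$ a finite discrete set and $f:V\to2^V$. An inverse system satisfies the Mittag-Leffler condition if for every $\lambda$ there is $\gamma\ge\lambda$ such that the image in the $\lambda$-th space of the $\gamma$-th space equals the image of the $\eta$-th space for all $\eta\ge\gamma$. An inverse system of multivalued systems $\{g^\eta_\lambda,(X_\lambda,f_\lambda)\}$ over a directed set consists of multivalued systems and continuous maps $g^\eta_\lambda:X_\eta\to X_\lambda$ ($\lambda\le\eta$) with $g^\eta_\lambda(f_\eta(x))\subset f_\lambda(g^\eta_\lambda(x))$, $g^\lambda_\lambda=\mathrm{id}$, $g^\nu_\lambda=g^\eta_\lambda\circ g^\nu_\eta$ for $\lambda\le\eta\le\nu$, and such that $(g^\eta_\lambda,X_\lambda)$ satisfies the Mittag-Leffler condition. Its inverse limit is $\varprojlim X_\lambda=\{(x_\lambda)\in\prod X_\lambda:x_\lambda=g^\eta_\lambda(x_\eta)\ \forall\lambda\le\eta\}$ with $\varprojlim f_\lambda((x_\lambda))=\{(y_\lambda)\in\varprojlim X_\lambda:y_\lambda\in f_\lambda(x_\lambda)\ \forall\lambda\}$. The induced map on orbit spaces is $(g^\eta_\lambda)^*:\mathrm{Orb}_{f_\eta}(X_\eta)\to\mathrm{Orb}_{f_\lambda}(X_\lambda)$, $(x_i)_i\mapsto(g^\eta_\lambda(x_i))_i$. *)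

theory Defs
  imports "HOL-Analysis.Analysis"
begin

text \<open>Spaces are abstract topologies with an explicit carrier; maps, whether multivalued or
single-valued, are constrained only on carriers.\<close>

definition totally_disconnected_space :: "'a topology \<Rightarrow> bool" where
  "totally_disconnected_space X \<longleftrightarrow> (\<forall>S. connectedin X S \<longrightarrow> (\<exists>a. S \<subseteq> {a}))"

definition multivalued_map :: "'a topology \<Rightarrow> ('a \<Rightarrow> 'a set) \<Rightarrow> bool" where
  "multivalued_map X f \<longleftrightarrow>
     (\<forall>x \<in> topspace X. f x \<noteq> {} \<and> closedin X (f x)) \<and>
     (\<forall>x \<in> topspace X. \<forall>U. openin X U \<and> f x \<subseteq> U \<longrightarrow>
        (\<exists>V. openin X V \<and> x \<in> V \<and> (\<forall>y \<in> V. f y \<subseteq> U)))"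

definition orbits :: "'a topology \<Rightarrow> ('a \<Rightarrow> 'a set) \<Rightarrow> (nat \<Rightarrow> 'a) set" where
  "orbits X f = {x. (\<forall>i. x i \<in> topspace X) \<and> (\<forall>i. x (Suc i) \<in> f (x i))}"

definition orbit_space :: "'a topology \<Rightarrow> ('a \<Rightarrow> 'a set) \<Rightarrow> (nat \<Rightarrow> 'a) topology" where
  "orbit_space X f = subtopology (product_topology (\<lambda>_. X) UNIV) (orbits X f)"

definition conjugate ::
  "'a topology \<Rightarrow> ('a \<Rightarrow> 'a set) \<Rightarrow> 'b topology \<Rightarrow> ('b \<Rightarrow> 'b set) \<Rightarrow> bool" where
  "conjugate X f Y g \<longleftrightarrow>
     (\<exists>p. homeomorphic_map X Y p \<and>
          (\<forall>x \<in> topspace X. f x = {z \<in> topspace X. p z \<in> g (p x)}))"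

definition finite_open_cover :: "'a topology \<Rightarrow> 'a set set \<Rightarrow> bool" where
  "finite_open_cover X \<U> \<longleftrightarrow> finite \<U> \<and> (\<forall>U \<in> \<U>. openin X U) \<and> \<Union>\<U> = topspace X"

definition pseudo_orbit ::
  "'a topology \<Rightarrow> ('a \<Rightarrow> 'a set) \<Rightarrow> 'a set set \<Rightarrow> (nat \<Rightarrow> 'a) \<Rightarrow> bool" where
  "pseudo_orbit X f \<V> x \<longleftrightarrow>
     (\<forall>i. x i \<in> topspace X) \<and>
     (\<forall>i. \<exists>V \<in> \<V>. f (x i) \<inter> V \<noteq> {} \<and> x (Suc i) \<in> V)"

definition shadows :: "'a set set \<Rightarrow> (nat \<Rightarrow> 'a) \<Rightarrow> (nat \<Rightarrow> 'a) \<Rightarrow> bool" where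
  "shadows \<U> z x \<longleftrightarrow> (\<forall>i. \<exists>U \<in> \<U>. x i \<in> U \<and> z i \<in> U)"

definition shadowing_property :: "'a topology \<Rightarrow> ('a \<Rightarrow> 'a set) \<Rightarrow> bool" where
  "shadowing_property X f \<longleftrightarrow>
     (\<forall>\<U>. finite_open_cover X \<U> \<longrightarrow>
        (\<exists>\<V>. finite_open_cover X \<V> \<and>
           (\<forall>x. pseudo_orbit X f \<V> x \<longrightarrow> (\<exists>z \<in> orbits X f. shadows \<U> z x))))"

definition finite_type_system :: "'a topology \<Rightarrow> ('a \<Rightarrow> 'a set) \<Rightarrow> bool" where
  "finite_type_system X f \<longleftrightarrow>
     finite (topspace X) \<and> X = discrete_topology (topspace X) \<and> multivalued_map X f"

text \<open>Directed sets are nonempty and preordered; antisymmetry is not required.\<close>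

definition directed_set :: "'i set \<Rightarrow> ('i \<Rightarrow> 'i \<Rightarrow> bool) \<Rightarrow> bool" where
  "directed_set \<Lambda> le \<longleftrightarrow>
     \<Lambda> \<noteq> {} \<and> reflp_on \<Lambda> le \<and> transp_on \<Lambda> le \<and>
     (\<forall>l \<in> \<Lambda>. \<forall>m \<in> \<Lambda>. \<exists>n \<in> \<Lambda>. le l n \<and> le m n)"

text \<open>Throughout, \<open>g l h\<close> is the bonding map from the space at index \<open>h\<close> to the space at
index \<open>l\<close>, for \<open>le l h\<close>.\<close>

definition mittag_leffler ::
  "'i set \<Rightarrow> ('i \<Rightarrow> 'i \<Rightarrow> bool) \<Rightarrow> ('i \<Rightarrow> 'b topology) \<Rightarrow> ('i \<Rightarrow> 'i \<Rightarrow> 'b \<Rightarrow> 'b) \<Rightarrow> bool" where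
  "mittag_leffler \<Lambda> le X g \<longleftrightarrow>
     (\<forall>l \<in> \<Lambda>. \<exists>c \<in> \<Lambda>. le l c \<and>
        (\<forall>h \<in> \<Lambda>. le c h \<longrightarrow> g l c ` topspace (X c) = g l h ` topspace (X h)))"

definition inverse_system ::
  "'i set \<Rightarrow> ('i \<Rightarrow> 'i \<Rightarrow> bool) \<Rightarrow> ('i \<Rightarrow> 'b topology) \<Rightarrow> ('i \<Rightarrow> 'b \<Rightarrow> 'b set)
     \<Rightarrow> ('i \<Rightarrow> 'i \<Rightarrow> 'b \<Rightarrow> 'b) \<Rightarrow> bool" where
  "inverse_system \<Lambda> le X f g \<longleftrightarrow>
     directed_set \<Lambda> le \<and>
     (\<forall>l \<in> \<Lambda>. multivalued_map (X l) (f l)) \<and>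
     (\<forall>l \<in> \<Lambda>. \<forall>h \<in> \<Lambda>. le l h \<longrightarrow>
        continuous_map (X h) (X l) (g l h) \<and>
        (\<forall>x \<in> topspace (X h). g l h ` f h x \<subseteq> f l (g l h x))) \<and>
     (\<forall>l \<in> \<Lambda>. \<forall>x \<in> topspace (X l). g l l x = x) \<and>
     (\<forall>l \<in> \<Lambda>. \<forall>h \<in> \<Lambda>. \<forall>n \<in> \<Lambda>. le l h \<and> le h n \<longrightarrow>
        (\<forall>x \<in> topspace (X n). g l n x = g l h (g h n x))) \<and>
     mittag_leffler \<Lambda> le X g"

definition inverse_limit_space ::
  "'i set \<Rightarrow> ('i \<Rightarrow> 'i \<Rightarrow> bool) \<Rightarrow> ('i \<Rightarrow> 'b topology) \<Rightarrow> ('i \<Rightarrow> 'i \<Rightarrow> 'b \<Rightarrow> 'b)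
     \<Rightarrow> ('i \<Rightarrow> 'b) topology" where
  "inverse_limit_space \<Lambda> le X g =
     subtopology (product_topology X \<Lambda>)
       {x. \<forall>l \<in> \<Lambda>. \<forall>h \<in> \<Lambda>. le l h \<longrightarrow> x l = g l h (x h)}"

definition inverse_limit_map ::
  "'i set \<Rightarrow> ('i \<Rightarrow> 'i \<Rightarrow> bool) \<Rightarrow> ('i \<Rightarrow> 'b topology) \<Rightarrow> ('i \<Rightarrow> 'b \<Rightarrow> 'b set)
     \<Rightarrow> ('i \<Rightarrow> 'i \<Rightarrow> 'b \<Rightarrow> 'b) \<Rightarrow> ('i \<Rightarrow> 'b) \<Rightarrow> ('i \<Rightarrow> 'b) set" where
  "inverse_limit_map \<Lambda> le X f g x =
     {y \<in> topspace (inverse_limit_space \<Lambda> le X g). \<forall>l \<in> \<Lambda>. y l \<in> f l (x l)}"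

definition induced_orbit_map ::
  "('i \<Rightarrow> 'i \<Rightarrow> 'b \<Rightarrow> 'b) \<Rightarrow> 'i \<Rightarrow> 'i \<Rightarrow> (nat \<Rightarrow> 'b) \<Rightarrow> (nat \<Rightarrow> 'b)" where
  "induced_orbit_map g l h x = (\<lambda>i. g l h (x i))"

definition conjugate_to_finite_type_limit ::
  "'a topology \<Rightarrow> ('a \<Rightarrow> 'a set) \<Rightarrow> 'i set \<Rightarrow> ('i \<Rightarrow> 'i \<Rightarrow> bool) \<Rightarrow> ('i \<Rightarrow> 'v topology)
     \<Rightarrow> ('i \<Rightarrow> 'v \<Rightarrow> 'v set) \<Rightarrow> ('i \<Rightarrow> 'i \<Rightarrow> 'v \<Rightarrow> 'v) \<Rightarrow> bool" where
  "conjugate_to_finite_type_limit X f \<Lambda> le V fV g \<longleftrightarrow>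
     inverse_system \<Lambda> le V fV g \<and>
     (\<forall>l \<in> \<Lambda>. finite_type_system (V l) (fV l)) \<and>
     mittag_leffler \<Lambda> le (\<lambda>l. orbit_space (V l) (fV l)) (induced_orbit_map g) \<and>
     conjugate X f (inverse_limit_space \<Lambda> le V g) (inverse_limit_map \<Lambda> le V fV g)"

end

theory Submission
  imports Defs
begin

text \<open>For the forward direction the index set consists of the finite clopen partitions of \<open>X\<close>,
directed by refinement, with an edge from \<open>A\<close> to \<open>B\<close> whenever \<open>f\<close> maps some point of \<open>A\<close> to a set
meeting \<open>B\<close>. A path in a sufficiently fine partition is the itinerary of a pseudo-orbit, and
the itinerary of a shadowing orbit lifts the coarsened path to all finer partitions; this is the
Mittag-Leffler condition on orbits. For the converse, an itinerary of a pseudo-orbit is a path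
at a stage \<open>c\<close>; by the Mittag-Leffler condition its projection to an earlier stage lifts to every
later stage, and by compactness these lifts can be chosen coherently, which gives an orbit of
the limit.\<close>

section \<open>Directed sets and compactness\<close>

lemma directed_set_upper_bound:
  assumes "directed_set \<Lambda> le" "finite J" "J \<subseteq> \<Lambda>"
  obtains u where "u \<in> \<Lambda>" "\<And>j. j \<in> J \<Longrightarrow> le j u"
proof -
  have "\<exists>u\<in>\<Lambda>. \<forall>j\<in>J. le j u"
    using assms(2,3)
  proof (induction J rule: finite_induct)
    case empty
    then show ?case using assms(1) by (auto simp: directed_set_def)
  next
    case (insert a J)
    then obtain u where u: "u \<in> \<Lambda>" "\<forall>j\<in>J. le j u" by auto
    with insert.prems obtain n where n: "n \<in> \<Lambda>" "le a n" "le u n"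
      using assms(1) unfolding directed_set_def by blast
    have "le j n" if "j \<in> J" for j
      using assms(1) u n that insert.prems unfolding directed_set_def
      by (meson insert_subset subsetD transp_onD)
    with n show ?case by auto
  qed
  with that show thesis by blast
qed

text \<open>Finitely many of the sets all contain the set at a common upper bound of their indices,
  so the family has the finite intersection property. Both passages from stages to the limit use
  this: lifting a path to the limit, and finding the point behind a thread of blocks.\<close>

lemma compact_space_directed_Inter_nonempty:
  assumes "compact_space X" "directed_set \<Lambda> le"
    and closed: "\<And>l. l \<in> \<Lambda> \<Longrightarrow> closedin X (F l)"
    and nonempty: "\<And>l. l \<in> \<Lambda> \<Longrightarrow> F l \<noteq> {}"
    and antimono: "\<And>l h. l \<in> \<Lambda> \<Longrightarrow> h \<in> \<Lambda> \<Longrightarrow> le l h \<Longrightarrow> F h \<subseteq> F l"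
  shows "\<exists>x\<in>topspace X. \<forall>l\<in>\<Lambda>. x \<in> F l"
proof -
  have fip: "\<Inter>\<F> \<noteq> {}" if \<F>: "finite \<F>" "\<F> \<subseteq> F ` \<Lambda>" for \<F>
  proof -
    obtain J where J: "finite J" "J \<subseteq> \<Lambda>" "\<F> = F ` J"
      using \<F> by (meson finite_subset_image)
    obtain u where u: "u \<in> \<Lambda>" "\<And>j. j \<in> J \<Longrightarrow> le j u"
      using directed_set_upper_bound[OF assms(2) J(1,2)] by blast
    have "F u \<subseteq> F j" if "j \<in> J" for j
      using that J(2) by (intro antimono u) auto
    then have "F u \<subseteq> \<Inter>\<F>" unfolding J(3) by (rule INT_greatest)
    then show ?thesis using nonempty[OF u(1)] by blast
  qed
  have "\<Inter>(F ` \<Lambda>) \<noteq> {}"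
    using assms(1)[unfolded compact_space_fip, rule_format, of "F ` \<Lambda>"] closed fip by auto
  then obtain x where x: "\<forall>l\<in>\<Lambda>. x \<in> F l" by blast
  obtain l where "l \<in> \<Lambda>" using assms(2) by (auto simp: directed_set_def)
  with x closed show ?thesis by (meson closedin_subset subsetD)
qed

text \<open>A Lebesgue number lemma in which an index takes the place of the number: each point has
  a fibre inside a member of the cover, finitely many of these fibres cover \<open>X\<close>, and an
  upper bound of their indices works for all points. It serves both directions, with
  \<open>q\<close> the coordinates of a conjugacy or the blocks of partitions.\<close>

lemma directed_fibres_refine_cover:
  assumes "compact_space X" "directed_set \<Lambda> le"
    and fibre_open: "\<And>l x. l \<in> \<Lambda> \<Longrightarrow> x \<in> topspace X \<Longrightarrow> openin X {y \<in> topspace X. q l y = q l x}"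
    and mono: "\<And>l h x y. \<lbrakk>l \<in> \<Lambda>; h \<in> \<Lambda>; le l h; x \<in> topspace X; y \<in> topspace X; q h y = q h x\<rbrakk>
                 \<Longrightarrow> q l y = q l x"
    and base: "\<And>U x. openin X U \<Longrightarrow> x \<in> U \<Longrightarrow>
                 \<exists>l\<in>\<Lambda>. \<forall>y\<in>topspace X. q l y = q l x \<longrightarrow> y \<in> U"
    and cover: "\<And>U. U \<in> \<U> \<Longrightarrow> openin X U" "\<Union>\<U> = topspace X"
  obtains l where "l \<in> \<Lambda>"
    "\<And>x. x \<in> topspace X \<Longrightarrow> \<exists>U\<in>\<U>. \<forall>y\<in>topspace X. q l y = q l x \<longrightarrow> y \<in> U"
proof -
  have "\<exists>l U. l \<in> \<Lambda> \<and> U \<in> \<U> \<and> (\<forall>y\<in>topspace X. q l y = q l x \<longrightarrow> y \<in> U)"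
    if "x \<in> topspace X" for x
    using that base cover by (metis Union_iff)
  then obtain m W where mW: "\<And>x. x \<in> topspace X \<Longrightarrow>
      m x \<in> \<Lambda> \<and> W x \<in> \<U> \<and> (\<forall>y\<in>topspace X. q (m x) y = q (m x) x \<longrightarrow> y \<in> W x)"
    by metis
  define C where "C x = {y \<in> topspace X. q (m x) y = q (m x) x}" for x
  have "\<exists>\<F>. finite \<F> \<and> \<F> \<subseteq> C ` topspace X \<and> topspace X \<subseteq> \<Union>\<F>"
  proof -
    have "\<forall>U\<in>C ` topspace X. openin X U" using fibre_open mW by (auto simp: C_def)
    moreover have "topspace X \<subseteq> \<Union>(C ` topspace X)" by (auto simp: C_def)
    ultimately show ?thesis using assms(1) unfolding compact_space_alt by blast
  qed
  then obtain S where S: "finite S" "S \<subseteq> topspace X" "topspace X \<subseteq> \<Union>(C ` S)"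
    by (metis finite_subset_image)
  have "finite (m ` S)" "m ` S \<subseteq> \<Lambda>" using S mW by auto
  then obtain l where l: "l \<in> \<Lambda>" "\<And>j. j \<in> m ` S \<Longrightarrow> le j l"
    using directed_set_upper_bound[OF assms(2)] by metis
  have "\<exists>U\<in>\<U>. \<forall>y\<in>topspace X. q l y = q l x \<longrightarrow> y \<in> U" if x: "x \<in> topspace X" for x
  proof -
    obtain s where s: "s \<in> S" "x \<in> C s" using S(3) x by auto
    then have sX: "s \<in> topspace X" using S(2) by auto
    \<comment> \<open>The fibre of \<open>x\<close> at \<open>l\<close> lies in its fibre at
      \<open>m s\<close>, which is the selected fibre \<open>C s\<close>.\<close>
    have "y \<in> W s" if y: "y \<in> topspace X" "q l y = q l x" for y
    proof -
      have "q (m s) y = q (m s) x" using mono[OF _ l(1) l(2) x y(1) y(2)] mW[OF sX] s(1) by blast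
      also have "\<dots> = q (m s) s" using s(2) by (simp add: C_def)
      finally show ?thesis using mW[OF sX] y by blast
    qed
    then show ?thesis using mW[OF sX] by blast
  qed
  with l(1) that show thesis by blast
qed

lemma closedin_Collect_ball:
  assumes "\<And>i. i \<in> I \<Longrightarrow> closedin X {x \<in> topspace X. Q i x}"
  shows "closedin X {x \<in> topspace X. \<forall>i\<in>I. Q i x}"
proof -
  \<comment> \<open>The extra member \<open>topspace X\<close> keeps the intersected family nonempty
    when \<open>I\<close> is empty.\<close>
  have "{x \<in> topspace X. \<forall>i\<in>I. Q i x} = \<Inter>(insert (topspace X) ((\<lambda>i. {x \<in> topspace X. Q i x}) ` I))"
    by auto
  also have "closedin X \<dots>" by (rule closedin_Inter) (use assms in auto)
  finally show ?thesis .
qed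

lemma topspace_orbit_space [simp]: "topspace (orbit_space X f) = orbits X f"
  by (auto simp: orbit_space_def orbits_def)

lemma induced_orbit_map_in_orbits:
  assumes "inverse_system \<Lambda> le V fV g" "l \<in> \<Lambda>" "h \<in> \<Lambda>" "le l h" "u \<in> orbits (V h) (fV h)"
  shows "induced_orbit_map g l h u \<in> orbits (V l) (fV l)"
proof -
  have "continuous_map (V h) (V l) (g l h)"
    "\<forall>x \<in> topspace (V h). g l h ` fV h x \<subseteq> fV l (g l h x)"
    using assms(1-4) unfolding inverse_system_def by blast+
  with assms(5) show ?thesis
    by (fastforce simp: orbits_def induced_orbit_map_def continuous_map_def)
qed

section \<open>Limits of finite type systems have the shadowing property\<close>

context
  fixes \<Lambda> :: "'i set" and le and V :: "'i \<Rightarrow> 'v topology" and fV g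
  assumes sys: "inverse_system \<Lambda> le V fV g"
    and fin: "\<And>l. l \<in> \<Lambda> \<Longrightarrow> finite_type_system (V l) (fV l)"
begin

lemma index_directed: "directed_set \<Lambda> le"
  using sys by (simp add: inverse_system_def)

lemma bonding_compose:
  "\<lbrakk>l \<in> \<Lambda>; h \<in> \<Lambda>; n \<in> \<Lambda>; le l h; le h n; x \<in> topspace (V n)\<rbrakk> \<Longrightarrow> g l n x = g l h (g h n x)"
  using sys unfolding inverse_system_def by blast

lemma bonding_in_topspace:
  "\<lbrakk>l \<in> \<Lambda>; h \<in> \<Lambda>; le l h; x \<in> topspace (V h)\<rbrakk> \<Longrightarrow> g l h x \<in> topspace (V l)"
  using sys unfolding inverse_system_def continuous_map_def by blast

lemma bonding_respects_map:
  "\<lbrakk>l \<in> \<Lambda>; h \<in> \<Lambda>; le l h; x \<in> topspace (V h); y \<in> fV h x\<rbrakk> \<Longrightarrow> g l h y \<in> fV l (g l h x)"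
  using sys unfolding inverse_system_def by blast

lemma index_refl: "l \<in> \<Lambda> \<Longrightarrow> le l l"
  using index_directed by (simp add: directed_set_def reflp_on_def)

lemma index_trans: "\<lbrakk>l \<in> \<Lambda>; h \<in> \<Lambda>; n \<in> \<Lambda>; le l h; le h n\<rbrakk> \<Longrightarrow> le l n"
  using index_directed unfolding directed_set_def by (meson transp_onD)

lemma openin_stage: "l \<in> \<Lambda> \<Longrightarrow> openin (V l) S \<longleftrightarrow> S \<subseteq> topspace (V l)"
  using fin unfolding finite_type_system_def by (metis openin_discrete_topology)

lemma compact_stage: "l \<in> \<Lambda> \<Longrightarrow> compact_space (V l)"
  using fin unfolding finite_type_system_def by (simp add: compact_space_def finite_imp_compactin)

text \<open>Points of this space are arbitrary families indexed by time and stage. The orbit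
  condition and compatibility with the bonding maps are imposed later as closed conditions, so that
  compactness of the full product applies.\<close>

abbreviation "paths \<equiv> product_topology (\<lambda>_::nat. product_topology V \<Lambda>) UNIV"

lemma compact_paths: "compact_space paths"
  by (simp add: compact_space_product_topology compact_stage)

text \<open>The stages are discrete, so both coordinates are locally constant in \<open>x\<close>.
  The failure of any relation between them therefore persists on a neighbourhood.\<close>

lemma closedin_paths:
  assumes "a \<in> \<Lambda>" "b \<in> \<Lambda>"
  shows "closedin paths {x \<in> topspace paths. Q (x i a) (x j b)}"
proof -
  have cont: "continuous_map paths (V a) (\<lambda>x. x i a)" if "a \<in> \<Lambda>" for a i
    using that continuous_map_compose[of paths "product_topology V \<Lambda>" "\<lambda>x. x i" "V a" "\<lambda>y. y a"]
      continuous_map_product_projection[of i UNIV "\<lambda>_. product_topology V \<Lambda>"]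
    by (simp add: o_def)
  have "openin paths {x \<in> topspace paths. \<not> Q (x i a) (x j b)}"
  proof (subst openin_subopen, intro ballI)
    fix x assume "x \<in> {x \<in> topspace paths. \<not> Q (x i a) (x j b)}"
    then have x: "x \<in> topspace paths" "\<not> Q (x i a) (x j b)" by auto
    let ?T = "{y \<in> topspace paths. y i a \<in> {x i a}} \<inter> {y \<in> topspace paths. y j b \<in> {x j b}}"
    have "x i a \<in> topspace (V a)" "x j b \<in> topspace (V b)"
      using x(1) assms by (auto simp: PiE_iff)
    then have "openin paths ?T"
      by (intro openin_Int openin_continuous_map_preimage[OF cont]) (use assms in \<open>auto simp: openin_stage\<close>)
    moreover have "x \<in> ?T" using x by blast
    moreover have "?T \<subseteq> {x \<in> topspace paths. \<not> Q (x i a) (x j b)}" using x by auto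
    ultimately show "\<exists>T. openin paths T \<and> x \<in> T \<and> T \<subseteq> {x \<in> topspace paths. \<not> Q (x i a) (x j b)}"
      by blast
  qed
  moreover have "topspace paths - {x \<in> topspace paths. Q (x i a) (x j b)}
      = {x \<in> topspace paths. \<not> Q (x i a) (x j b)}" by blast
  ultimately show ?thesis unfolding closedin_def by auto
qed

text \<open>The lifts of \<open>w\<close> to different stages need not be compatible. The set
  \<open>F h\<close> collects the candidates that are correct up to stage \<open>h\<close>; these
  sets are closed, nonempty and decreasing in \<open>h\<close>, so compactness yields a candidate
  correct at every stage.\<close>

lemma orbit_lifts_to_limit:
  assumes lc: "l \<in> \<Lambda>"
    and nonempty: "\<And>h. h \<in> \<Lambda> \<Longrightarrow> topspace (V h) \<noteq> {}"
    and lifts: "\<And>h. h \<in> \<Lambda> \<Longrightarrow> \<exists>n\<in>\<Lambda>. le h n \<and> le l n \<and> w \<in> induced_orbit_map g l n ` orbits (V n) (fV n)"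
  obtains x where "x \<in> orbits (inverse_limit_space \<Lambda> le V g) (inverse_limit_map \<Lambda> le V fV g)"
    "\<And>i. x i l = w i"
proof -
  define F where "F h = {x \<in> topspace paths. \<forall>i\<in>UNIV. x i l = w i \<and>
    x (Suc i) h \<in> fV h (x i h) \<and> (\<forall>m\<in>{m\<in>\<Lambda>. le m h}. x i m = g m h (x i h))}" for h
  have closed: "closedin paths (F h)" if "h \<in> \<Lambda>" for h
  proof -
    have "F h = {x \<in> topspace paths. \<forall>i\<in>UNIV. x i l = w i} \<inter>
        {x \<in> topspace paths. \<forall>i\<in>UNIV. x (Suc i) h \<in> fV h (x i h)} \<inter>
        {x \<in> topspace paths. \<forall>i\<in>UNIV. \<forall>m\<in>{m\<in>\<Lambda>. le m h}. x i m = g m h (x i h)}"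
      unfolding F_def by blast
    also have "closedin paths \<dots>"
      by (intro closedin_Int closedin_Collect_ball
          closedin_paths[where Q="\<lambda>s t. s = w _"]
          closedin_paths[where Q="\<lambda>s t. s \<in> fV h t"] closedin_paths[where Q="\<lambda>s t. s = g _ h t"])
        (use that lc in auto)
    finally show ?thesis .
  qed
  \<comment> \<open>\<open>F h\<close> asks for the orbit condition only at stage \<open>h\<close>;
    the bonding maps carry it down from later stages.\<close>
  have antimono: "F n \<subseteq> F h" if hn: "h \<in> \<Lambda>" "n \<in> \<Lambda>" "le h n" for h n
  proof
    fix x assume x: "x \<in> F n"
    then have xV: "x i n \<in> topspace (V n)" for i using hn by (auto simp: F_def PiE_iff)
    have xh: "x i h = g h n (x i n)" for i using x hn by (auto simp: F_def)
    have "x (Suc i) h \<in> fV h (x i h)" for i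
      using x hn xV xh by (auto simp: F_def intro: bonding_respects_map)
    moreover have "x i m = g m h (x i h)" if "m \<in> \<Lambda>" "le m h" for i m
    proof -
      have "x i m = g m n (x i n)" using x that hn index_trans[OF that(1) hn(1,2) that(2) hn(3)] by (auto simp: F_def)
      then show ?thesis using bonding_compose[OF that(1) hn(1,2) that(2) hn(3) xV] xh by simp
    qed
    ultimately show "x \<in> F h" using x by (auto simp: F_def)
  qed
  have F_nonempty: "F h \<noteq> {}" if h: "h \<in> \<Lambda>" for h
  proof -
    \<comment> \<open>A member is built at a stage \<open>n\<close> past both \<open>h\<close> and
      \<open>l\<close>, where \<open>w\<close> has a lift; antimonotonicity then brings it back to
      \<open>F h\<close>.\<close>
    obtain n u where n: "n \<in> \<Lambda>" "le h n" "le l n" and u: "u \<in> orbits (V n) (fV n)"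
      and w: "w = induced_orbit_map g l n u" using lifts[OF h] by blast
    \<comment> \<open>Default vertices fill the coordinates at indices not below \<open>n\<close>,
      on which \<open>F n\<close> imposes nothing.\<close>
    define e where "e m = (SOME v. v \<in> topspace (V m))" for m
    have e: "e m \<in> topspace (V m)" if "m \<in> \<Lambda>" for m
      using nonempty[OF that] unfolding e_def by (simp add: some_in_eq)
    define x where "x i = (\<lambda>m\<in>\<Lambda>. if le m n then g m n (u i) else e m)" for i
    have uV: "u i \<in> topspace (V n)" "u (Suc i) \<in> fV n (u i)" for i using u by (auto simp: orbits_def)
    have "g n n v = v" if "v \<in> topspace (V n)" for v
      using sys n(1) that unfolding inverse_system_def by blast
    moreover have "fV n (u i) \<subseteq> topspace (V n)" for i
      using sys n(1) uV(1) unfolding inverse_system_def multivalued_map_def by (meson closedin_subset)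
    ultimately have xn: "x i n = u i" for i using n uV index_refl[OF n(1)] by (simp add: x_def)
    have "x \<in> topspace paths"
      using uV e n by (auto simp: x_def PiE_iff bonding_in_topspace)
    then have "x \<in> F n"
      using lc n w uV by (auto simp: F_def xn) (auto simp: x_def induced_orbit_map_def)
    then show ?thesis using antimono[OF h n(1,2)] by blast
  qed
  obtain x where xP: "x \<in> topspace paths" and x: "\<And>h. h \<in> \<Lambda> \<Longrightarrow> x \<in> F h"
    using compact_space_directed_Inter_nonempty[of paths \<Lambda> le F, OF compact_paths index_directed closed F_nonempty antimono]
    by blast
  have "x i \<in> topspace (inverse_limit_space \<Lambda> le V g)" for i
    using xP x by (auto simp: inverse_limit_space_def F_def)
  moreover have "x (Suc i) m \<in> fV m (x i m)" if "m \<in> \<Lambda>" for i m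
    using x[OF that] by (auto simp: F_def)
  ultimately have "x \<in> orbits (inverse_limit_space \<Lambda> le V g) (inverse_limit_map \<Lambda> le V fV g)"
    by (auto simp: orbits_def inverse_limit_map_def)
  moreover have "x i l = w i" for i using x[OF lc] by (auto simp: F_def)
  ultimately show thesis by (rule that)
qed

text \<open>A basic open box restricts finitely many coordinates, and in the limit all of these are
  determined by the coordinate at an upper bound of their indices.\<close>

lemma inverse_limit_base:
  assumes "openin (inverse_limit_space \<Lambda> le V g) U" "x \<in> U"
  shows "\<exists>l\<in>\<Lambda>. \<forall>y\<in>topspace (inverse_limit_space \<Lambda> le V g). y l = x l \<longrightarrow> y \<in> U"
proof -
  let ?L = "inverse_limit_space \<Lambda> le V g"
  obtain T where T: "openin (product_topology V \<Lambda>) T"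
    "U = T \<inter> {x. \<forall>l \<in> \<Lambda>. \<forall>h \<in> \<Lambda>. le l h \<longrightarrow> x l = g l h (x h)}"
    using assms(1) unfolding inverse_limit_space_def openin_subtopology by blast
  obtain W where W: "finite {i \<in> \<Lambda>. W i \<noteq> topspace (V i)}" "x \<in> Pi\<^sub>E \<Lambda> W" "Pi\<^sub>E \<Lambda> W \<subseteq> T"
    using T(1)[unfolded openin_product_topology_alt] assms(2) T(2) by auto
  have "{i \<in> \<Lambda>. W i \<noteq> topspace (V i)} \<subseteq> \<Lambda>" by blast
  then obtain l where l: "l \<in> \<Lambda>" "\<And>j. j \<in> {i \<in> \<Lambda>. W i \<noteq> topspace (V i)} \<Longrightarrow> le j l"
    using directed_set_upper_bound[OF index_directed W(1)] by blast
  have "y \<in> U" if y: "y \<in> topspace ?L" "y l = x l" for y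
  proof -
    have yc: "\<forall>l \<in> \<Lambda>. \<forall>h \<in> \<Lambda>. le l h \<longrightarrow> y l = g l h (y h)"
      and yP: "y \<in> Pi\<^sub>E \<Lambda> (\<lambda>i. topspace (V i))"
      using y(1) by (auto simp: inverse_limit_space_def)
    have "y j \<in> W j" if j: "j \<in> \<Lambda>" for j
    proof (cases "W j = topspace (V j)")
      case True
      then show ?thesis using yP j by auto
    next
      case False
      then have "le j l" using l j by blast
      then have "y j = x j" using yc assms(2) T(2) j l(1) y(2) by auto
      then show ?thesis using W(2) j by auto
    qed
    then have "y \<in> Pi\<^sub>E \<Lambda> W" using yP by (auto simp: PiE_iff)
    then show ?thesis using W(3) yc T(2) by blast
  qed
  with l(1) show ?thesis by blast
qed

text \<open>Two scales are at work: pseudo-orbits are controlled at a stage \<open>c\<close>, while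
  shadowing is achieved at \<open>l\<close> with \<open>le l c\<close>, because it is the projection
  to \<open>l\<close> that the Mittag-Leffler condition lifts to all later stages.\<close>

lemma conjugate_limit_imp_shadowing:
  assumes comp: "compact_space X"
    and ml: "mittag_leffler \<Lambda> le (\<lambda>l. orbit_space (V l) (fV l)) (induced_orbit_map g)"
    and conj: "conjugate X f (inverse_limit_space \<Lambda> le V g) (inverse_limit_map \<Lambda> le V fV g)"
  shows "shadowing_property X f"
  unfolding shadowing_property_def
proof (intro allI impI)
  let ?L = "inverse_limit_space \<Lambda> le V g"
  fix \<U> assume \<U>: "finite_open_cover X \<U>"
  obtain p where p: "homeomorphic_map X ?L p"
    and fp: "\<And>x. x \<in> topspace X \<Longrightarrow>
      f x = {z \<in> topspace X. p z \<in> inverse_limit_map \<Lambda> le V fV g (p x)}"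
    using conj unfolding conjugate_def by blast
  have pL: "p x \<in> topspace ?L" if "x \<in> topspace X" for x
    using p that by (metis homeomorphic_imp_surjective_map imageI)
  have pV: "p x l \<in> topspace (V l)" if "x \<in> topspace X" "l \<in> \<Lambda>" for x l
    using pL[OF that(1)] that(2) by (auto simp: inverse_limit_space_def PiE_iff)
  have pc: "p x l = g l h (p x h)" if "x \<in> topspace X" "l \<in> \<Lambda>" "h \<in> \<Lambda>" "le l h" for x l h
    using pL[OF that(1)] that(2-) by (auto simp: inverse_limit_space_def)
  have cont: "continuous_map X (V l) (\<lambda>x. p x l)" if "l \<in> \<Lambda>" for l
  proof -
    have "continuous_map X (product_topology V \<Lambda>) p"
      using homeomorphic_imp_continuous_map[OF p]
      by (simp add: inverse_limit_space_def continuous_map_in_subtopology)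
    then show ?thesis using that by (simp add: continuous_map_componentwise)
  qed
  have fibre_open: "openin X {y \<in> topspace X. p y l \<in> S}" if "l \<in> \<Lambda>" "S \<subseteq> topspace (V l)" for l S
    using openin_continuous_map_preimage[OF cont[OF that(1)]] that by (simp add: openin_stage)
  have base: "\<exists>l\<in>\<Lambda>. \<forall>y\<in>topspace X. p y l = p x l \<longrightarrow> y \<in> U"
    if U: "openin X U" "x \<in> U" for U x
  proof -
    have UX: "U \<subseteq> topspace X" using U openin_subset by blast
    have "openin ?L (p ` U)" using homeomorphic_map_openness[OF p UX] U by simp
    then obtain l where l: "l \<in> \<Lambda>" "\<And>y. y \<in> topspace ?L \<Longrightarrow> y l = p x l \<Longrightarrow> y \<in> p ` U"
      using inverse_limit_base[of "p ` U" "p x"] U(2) by blast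
    have "y \<in> U" if "y \<in> topspace X" "p y l = p x l" for y
    proof -
      have "p y \<in> p ` U" using l(2) pL that by blast
      then show ?thesis
        using homeomorphic_imp_injective_map[OF p] that(1) UX by (meson inj_on_image_mem_iff)
    qed
    with l(1) show ?thesis by blast
  qed
  \<comment> \<open>Points whose images agree at stage \<open>l\<close> lie in a common member of
    \<open>\<U>\<close>.\<close>
  obtain l where l: "l \<in> \<Lambda>"
    "\<And>x. x \<in> topspace X \<Longrightarrow> \<exists>U\<in>\<U>. \<forall>y\<in>topspace X. p y l = p x l \<longrightarrow> y \<in> U"
  proof (rule directed_fibres_refine_cover[of X \<Lambda> le "\<lambda>l x. p x l" \<U>])
    show "openin X {y \<in> topspace X. p y l = p x l}" if "l \<in> \<Lambda>" "x \<in> topspace X" for l x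
      using fibre_open[of l "{p x l}"] pV that by simp
    show "p y l = p x l"
      if "l \<in> \<Lambda>" "h \<in> \<Lambda>" "le l h" "x \<in> topspace X" "y \<in> topspace X" "p y h = p x h" for l h x y
      using pc that by metis
    show "openin X U" if "U \<in> \<U>" for U using \<U> that by (simp add: finite_open_cover_def)
    show "\<Union>\<U> = topspace X" using \<U> by (simp add: finite_open_cover_def)
  qed (use comp index_directed base in auto)
  obtain c where c: "c \<in> \<Lambda>" "le l c"
    "\<And>h. h \<in> \<Lambda> \<Longrightarrow> le c h \<Longrightarrow> induced_orbit_map g l c ` orbits (V c) (fV c) =
        induced_orbit_map g l h ` orbits (V h) (fV h)"
    using ml l(1) unfolding mittag_leffler_def by auto
  \<comment> \<open>With the fibres at \<open>c\<close> as cover, the jumps of a pseudo-orbit stay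
    within a fibre and are invisible at stage \<open>c\<close>, so its projection there is an exact
    orbit.\<close>
  define \<V> where "\<V> = (\<lambda>v. {x \<in> topspace X. p x c = v}) ` topspace (V c)"
  have "finite_open_cover X \<V>"
    using fibre_open[OF c(1), of "{_}"] pV c(1) fin[OF c(1)]
    by (auto simp: finite_open_cover_def \<V>_def finite_type_system_def)
  moreover have "\<exists>z\<in>orbits X f. shadows \<U> z x" if x: "pseudo_orbit X f \<V> x" for x
  proof -
    have xX: "x i \<in> topspace X" for i using x by (simp add: pseudo_orbit_def)
    have "p (x (Suc i)) c \<in> fV c (p (x i) c)" for i
    proof -
      obtain y where "y \<in> f (x i)" "p y c = p (x (Suc i)) c"
        using x unfolding pseudo_orbit_def \<V>_def by fastforce
      then show ?thesis using fp[OF xX, of i] c(1) by (auto simp: inverse_limit_map_def)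
    qed
    then have orb: "(\<lambda>i. p (x i) c) \<in> orbits (V c) (fV c)"
      using pV xX c(1) by (auto simp: orbits_def)
    define w where "w = induced_orbit_map g l c (\<lambda>i. p (x i) c)"
    have w: "w i = p (x i) l" for i
      using pc[OF xX l(1) c(1,2)] by (simp add: w_def induced_orbit_map_def)
    \<comment> \<open>At a stage \<open>n\<close> past both \<open>h\<close> and \<open>c\<close>,
      the orbits have the same image in stage \<open>l\<close> as those at \<open>c\<close>.\<close>
    have "\<exists>n\<in>\<Lambda>. le h n \<and> le l n \<and> w \<in> induced_orbit_map g l n ` orbits (V n) (fV n)"
      if h: "h \<in> \<Lambda>" for h
    proof -
      obtain n where n: "n \<in> \<Lambda>" "le h n" "le c n"
        using index_directed h c(1) unfolding directed_set_def by metis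
      then show ?thesis
        using c(3)[OF n(1,3)] orb index_trans[OF l(1) c(1) n(1) c(2) n(3)] unfolding w_def by blast
    qed
    then obtain y where y: "y \<in> orbits ?L (inverse_limit_map \<Lambda> le V fV g)" "\<And>i. y i l = w i"
      using orbit_lifts_to_limit[OF l(1), of w] pV[OF xX] by blast
    have "\<exists>z. z \<in> topspace X \<and> p z = y i" for i
    proof -
      have "y i \<in> p ` topspace X"
        using y(1) homeomorphic_imp_surjective_map[OF p] by (simp add: orbits_def)
      then show ?thesis by (metis imageE)
    qed
    then obtain z where z: "\<And>i. z i \<in> topspace X" "\<And>i. p (z i) = y i" by metis
    have "z \<in> orbits X f" using z y(1) fp by (auto simp: orbits_def)
    moreover have "shadows \<U> z x"
      unfolding shadows_def
    proof
      fix i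
      have "p (z i) l = p (x i) l" using z y w by simp
      then show "\<exists>U\<in>\<U>. x i \<in> U \<and> z i \<in> U" using l(2)[OF xX[of i]] z(1) xX by blast
    qed
    ultimately show ?thesis by blast
  qed
  ultimately show "\<exists>\<V>. finite_open_cover X \<V> \<and>
      (\<forall>x. pseudo_orbit X f \<V> x \<longrightarrow> (\<exists>z\<in>orbits X f. shadows \<U> z x))" by blast
qed

end

lemma conjugate_to_finite_type_limit_imp_shadowing:
  assumes "compact_space X" "conjugate_to_finite_type_limit X f \<Lambda> le V fV g"
  shows "shadowing_property X f"
  by (rule conjugate_limit_imp_shadowing[of \<Lambda> le V fV g X f])
    (use assms in \<open>auto simp: conjugate_to_finite_type_limit_def\<close>)

section \<open>Clopen partitions\<close>

text \<open>Total disconnectedness makes the component of \<open>x\<close> equal to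
  \<open>{x}\<close>. In a compact Hausdorff space a component is separated by a clopen set from any
  closed set disjoint from it, here from the complement of \<open>U\<close>.\<close>

lemma clopen_base:
  assumes "compact_space X" "Hausdorff_space X" "totally_disconnected_space X"
    and "openin X U" "x \<in> U"
  obtains C where "openin X C" "closedin X C" "x \<in> C" "C \<subseteq> U"
proof -
  have x: "x \<in> topspace X" using assms(4,5) openin_subset by blast
  have "connectedin X (connected_component_of_set X x)"
    by (simp add: connectedin_connected_component_of)
  then obtain a where "connected_component_of_set X x \<subseteq> {a}"
    using assms(3) unfolding totally_disconnected_space_def by blast
  moreover have "x \<in> connected_component_of_set X x" using x by (simp add: connected_component_of_refl)
  ultimately have comp: "connected_component_of_set X x = {x}" by blast
  then have "{x} \<in> connected_components_of X" using x unfolding connected_components_of_def by blast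
  then have "separated_between X {x} (topspace X - U)"
    using assms x by (intro separated_between_compact_connected_component)
      (auto simp: compact_imp_locally_compact_space)
  then obtain C where "openin X C" "closedin X C" "x \<in> C" "topspace X - U \<subseteq> topspace X - C"
    unfolding separated_between by blast
  moreover from this have "C \<subseteq> U" using openin_subset by fast
  ultimately show thesis using that by blast
qed

text \<open>Open blocks are automatically clopen, since the complement of a block is the union of
  the other blocks.\<close>

definition clopen_partitions :: "'a topology \<Rightarrow> 'a set set set" where
  "clopen_partitions X = {P. finite P \<and> partition_on (topspace X) P \<and> (\<forall>A\<in>P. openin X A)}"

text \<open>The arguments of \<open>refines\<close> are swapped so that finer partitions are later
  indices.\<close>

abbreviation coarser :: "'a topology \<Rightarrow> 'a set set \<Rightarrow> 'a set set \<Rightarrow> bool" where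
  "coarser X l h \<equiv> refines (topspace X) h l"

definition block :: "'a set set \<Rightarrow> 'a \<Rightarrow> 'a set" where
  "block P x = (THE A. A \<in> P \<and> x \<in> A)"

lemma block_eqI:
  assumes "partition_on S P" "A \<in> P" "x \<in> A"
  shows "block P x = A"
  unfolding block_def
proof (rule the_equality)
  show "B = A" if "B \<in> P \<and> x \<in> B" for B
    using partition_onD2[OF assms(1)] that assms(2,3) by (auto dest: disjointD)
qed (use assms in auto)

lemma block_in:
  assumes "partition_on S P" "x \<in> S"
  shows "block P x \<in> P" "x \<in> block P x"
proof -
  obtain A where "A \<in> P" "x \<in> A" using assms partition_onD1 by blast
  with block_eqI[OF assms(1)] show "block P x \<in> P" "x \<in> block P x" by auto
qed

lemma in_block_iff:
  assumes "partition_on S P" "x \<in> S" "y \<in> S"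
  shows "y \<in> block P x \<longleftrightarrow> block P y = block P x"
  using block_in[OF assms(1)] block_eqI[OF assms(1)] assms(2,3) by metis

lemma block_image:
  assumes "partition_on S P"
  shows "block P ` S = P"
proof
  show "P \<subseteq> block P ` S"
  proof
    fix A assume A: "A \<in> P"
    then obtain x where "x \<in> A" using partition_onD3[OF assms] by fastforce
    with A show "A \<in> block P ` S" using block_eqI[OF assms A] partition_onD1[OF assms] by blast
  qed
qed (use block_in[OF assms] in auto)

lemma block_coarser:
  assumes "refines S h l" "x \<in> S" "y \<in> block h x"
  shows "block l y = block l x"
proof -
  have h: "partition_on S h" and l: "partition_on S l" using assms(1) by (auto simp: refines_def)
  obtain A where "A \<in> l" "block h x \<subseteq> A"
    using assms(1) block_in(1)[OF h assms(2)] unfolding refines_def by blast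
  then show ?thesis using block_eqI[OF l] block_in(2)[OF h assms(2)] assms(3) by blast
qed

lemma clopen_partitionsD: "P \<in> clopen_partitions X \<Longrightarrow> partition_on (topspace X) P"
  by (simp add: clopen_partitions_def)

lemma openin_block:
  "P \<in> clopen_partitions X \<Longrightarrow> x \<in> topspace X \<Longrightarrow> openin X (block P x)"
  by (metis (no_types, lifting) block_in(1) clopen_partitions_def mem_Collect_eq)

lemma clopen_partition_of_clopen:
  assumes "openin X C" "closedin X C"
  shows "{C, topspace X - C} - {{}} \<in> clopen_partitions X"
  using assms openin_subset[OF assms(1)]
  by (auto simp: clopen_partitions_def partition_on_def disjoint_def)

lemma directed_clopen_partitions: "directed_set (clopen_partitions X) (coarser X)"
proof -
  \<comment> \<open>The clopen set \<open>{}\<close> gives the one-block partition, or the empty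
    partition when \<open>X\<close> is empty.\<close>
  have "clopen_partitions X \<noteq> {}" using clopen_partition_of_clopen[of X "{}"] by auto
  moreover have "\<exists>n\<in>clopen_partitions X. coarser X l n \<and> coarser X m n"
    if lm: "l \<in> clopen_partitions X" "m \<in> clopen_partitions X" for l m
  proof
    let ?n = "common_refinement {l, m}"
    have P: "\<And>P. P \<in> {l, m} \<Longrightarrow> partition_on (topspace X) P"
      using lm by (auto dest: clopen_partitionsD)
    show "coarser X l ?n \<and> coarser X m ?n"
      using refines_common_refinement[of "{l, m}", OF P] by blast
    have "openin X A" if "A \<in> ?n" for A
      using that lm by (auto simp: common_refinement clopen_partitions_def Pi_iff)
    then show "?n \<in> clopen_partitions X"
      using partition_on_common_refinement[of "{l, m}", OF P] finite_common_refinement[of "{l, m}"] lm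
      by (auto simp: clopen_partitions_def)
  qed
  ultimately show ?thesis
    unfolding directed_set_def
    by (auto intro!: reflp_onI transp_onI refines_refl dest: clopen_partitionsD intro: refines_trans)
qed

lemma clopen_partition_base:
  assumes "compact_space X" "Hausdorff_space X" "totally_disconnected_space X"
    and "openin X U" "x \<in> U"
  shows "\<exists>P\<in>clopen_partitions X. block P x \<subseteq> U"
proof -
  obtain C where C: "openin X C" "closedin X C" "x \<in> C" "C \<subseteq> U"
    using clopen_base[OF assms] .
  let ?P = "{C, topspace X - C} - {{}}"
  have P: "?P \<in> clopen_partitions X" using clopen_partition_of_clopen C by blast
  have "C \<in> ?P" using C(3) by auto
  then have "block ?P x = C" using block_eqI[OF clopen_partitionsD[OF P]] C(3) by blast
  with P C(4) show ?thesis by metis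
qed

section \<open>Systems with shadowing as limits of finite type systems\<close>

definition partition_map :: "('a \<Rightarrow> 'a set) \<Rightarrow> 'a set set \<Rightarrow> 'a set \<Rightarrow> 'a set set" where
  "partition_map f P A = block P ` (\<Union>x\<in>A. f x)"

text \<open>On blocks of a refinement of \<open>l\<close> the choice does not matter; the index \<open>h\<close> only gives
\<open>coarsen\<close> the shape of a family of bonding maps.\<close>

definition coarsen :: "'a set set \<Rightarrow> 'a set set \<Rightarrow> 'a set \<Rightarrow> 'a set" where
  "coarsen l h A = block l (SOME x. x \<in> A)"

text \<open>This equation reduces computations with \<open>coarsen\<close> to points: a block is
  named by any of its points, and all of them share a block of \<open>l\<close>.\<close>

lemma coarsen_block:
  assumes "refines S h l" "x \<in> S"
  shows "coarsen l h (block h x) = block l x"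
proof -
  have "x \<in> block h x" using assms by (auto simp: refines_def intro: block_in)
  then show ?thesis
    unfolding coarsen_def using block_coarser[OF assms] by (metis someI)
qed

context
  fixes X :: "'a topology" and f :: "'a \<Rightarrow> 'a set"
  assumes comp: "compact_space X" and haus: "Hausdorff_space X"
    and td: "totally_disconnected_space X" and mv: "multivalued_map X f"
begin

lemma multivalued_map_subset: "x \<in> topspace X \<Longrightarrow> f x \<subseteq> topspace X"
  using mv by (simp add: multivalued_map_def closedin_subset)

lemma multivalued_map_nonempty: "x \<in> topspace X \<Longrightarrow> f x \<noteq> {}"
  using mv by (simp add: multivalued_map_def)

lemma finite_type_partition:
  assumes "P \<in> clopen_partitions X"
  shows "finite_type_system (discrete_topology P) (partition_map f P)"
proof -
  note P = clopen_partitionsD[OF assms]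
  have "partition_map f P A \<noteq> {} \<and> partition_map f P A \<subseteq> P" if "A \<in> P" for A
  proof -
    have A: "A \<subseteq> topspace X" "A \<noteq> {}"
      using that partition_onD1[OF P] partition_onD3[OF P] by auto
    then obtain x where "x \<in> A" "f x \<noteq> {}" using multivalued_map_nonempty by fast
    moreover have "block P y \<in> P" if "x \<in> A" "y \<in> f x" for x y
      using that A multivalued_map_subset block_in(1)[OF P] by fast
    ultimately show ?thesis unfolding partition_map_def by auto
  qed
  moreover have "finite P" using assms by (simp add: clopen_partitions_def)
  \<comment> \<open>In the discrete topology the singleton \<open>{A}\<close> is the neighbourhood
    that upper semicontinuity asks for.\<close>
  moreover have "\<exists>V. V \<subseteq> P \<and> A \<in> V \<and> (\<forall>B\<in>V. partition_map f P B \<subseteq> U)"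
    if "A \<in> P" "partition_map f P A \<subseteq> U" for A U
    using that by (intro exI[of _ "{A}"]) auto
  ultimately show ?thesis
    by (auto simp: finite_type_system_def multivalued_map_def)
qed

text \<open>An edge is witnessed by a point \<open>a\<close> of the block and a point
  \<open>y\<close> of \<open>f a\<close>; the same two points witness the edge between the coarser
  blocks.\<close>

lemma coarsen_partition_map:
  assumes "refines (topspace X) h l" "A \<in> h"
  shows "coarsen l h A \<in> l" "coarsen l h ` partition_map f h A \<subseteq> partition_map f l (coarsen l h A)"
proof -
  have h: "partition_on (topspace X) h" and l: "partition_on (topspace X) l"
    using assms(1) by (auto simp: refines_def)
  obtain x where x: "x \<in> topspace X" "A = block h x" using block_image[OF h] assms(2) by blast
  show "coarsen l h A \<in> l" using x coarsen_block[OF assms(1)] block_in[OF l] by simp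
  show "coarsen l h ` partition_map f h A \<subseteq> partition_map f l (coarsen l h A)"
  proof
    fix B assume "B \<in> coarsen l h ` partition_map f h A"
    then obtain a y where a: "a \<in> A" "y \<in> f a" "B = coarsen l h (block h y)"
      unfolding partition_map_def by auto
    have aX: "a \<in> topspace X" using a(1) assms(2) partition_onD1[OF h] by blast
    then have "y \<in> topspace X" using a(2) multivalued_map_subset by blast
    then have "B = block l y" using a(3) coarsen_block[OF assms(1)] by simp
    moreover have "a \<in> coarsen l h A"
      using block_coarser[OF assms(1) x(1)] a(1) x coarsen_block[OF assms(1)] block_in(2)[OF l aX] by simp
    ultimately show "B \<in> partition_map f l (coarsen l h A)"
      using a(2) unfolding partition_map_def by blast
  qed
qed

lemma partition_inverse_system:
  "inverse_system (clopen_partitions X) (coarser X) discrete_topology (partition_map f) coarsen"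
proof -
  \<comment> \<open>Every block is the block of some point, so the bonding maps are onto. The
    Mittag-Leffler condition on the spaces then holds with \<open>l\<close> itself as the required
    index.\<close>
  have surj: "coarsen l h ` h = l" if "coarser X l h" for l h
  proof -
    have "partition_on (topspace X) h" "partition_on (topspace X) l"
      using that by (auto simp: refines_def)
    then have "coarsen l h ` h = coarsen l h ` block h ` topspace X" "l = block l ` topspace X"
      by (simp_all add: block_image)
    moreover have "coarsen l h ` block h ` topspace X = block l ` topspace X"
      by (simp add: image_image coarsen_block[OF that])
    ultimately show ?thesis by simp
  qed
  have refl: "coarser X l l" if "l \<in> clopen_partitions X" for l
    using clopen_partitionsD[OF that] by (rule refines_refl)
  have comp_id: "coarsen l l A = A" if "l \<in> clopen_partitions X" "A \<in> l" for l A
    using that block_image[OF clopen_partitionsD[OF that(1)]] coarsen_block[OF refl[OF that(1)]]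
    by (metis imageE)
  have comp: "coarsen l n A = coarsen l h (coarsen h n A)"
    if "coarser X l h" "coarser X h n" "A \<in> n" for l h n A
  proof -
    have "partition_on (topspace X) n" using that by (simp add: refines_def)
    from block_image[OF this] that(3) obtain x where "x \<in> topspace X" "A = block n x" by blast
    then show ?thesis
      using coarsen_block that refines_trans[OF that(2,1)] by metis
  qed
  have mlc: "mittag_leffler (clopen_partitions X) (coarser X) discrete_topology coarsen"
    unfolding mittag_leffler_def
  proof
    fix l assume "l \<in> clopen_partitions X"
    with refl[OF this] surj show "\<exists>c\<in>clopen_partitions X. coarser X l c \<and>
        (\<forall>h\<in>clopen_partitions X. coarser X c h \<longrightarrow>
          coarsen l c ` topspace (discrete_topology c) = coarsen l h ` topspace (discrete_topology h))"
      by (intro bexI[of _ l]) simp_all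
  qed
  have "multivalued_map (discrete_topology l) (partition_map f l)" if "l \<in> clopen_partitions X" for l
    using finite_type_partition[OF that] by (simp add: finite_type_system_def)
  moreover have "continuous_map (discrete_topology h) (discrete_topology l) (coarsen l h)"
    if "coarser X l h" for l h
    using coarsen_partition_map(1)[OF that] by auto
  ultimately show ?thesis
    unfolding inverse_system_def
    using directed_clopen_partitions mlc comp_id comp coarsen_partition_map by simp
qed

lemma partition_orbits_mittag_leffler:
  assumes "shadowing_property X f"
  shows "mittag_leffler (clopen_partitions X) (coarser X)
    (\<lambda>l. orbit_space (discrete_topology l) (partition_map f l)) (induced_orbit_map coarsen)"
  unfolding mittag_leffler_def topspace_orbit_space
proof
  let ?orb = "\<lambda>l. orbits (discrete_topology l) (partition_map f l)"
  let ?ind = "induced_orbit_map (coarsen :: 'a set set \<Rightarrow> 'a set set \<Rightarrow> 'a set \<Rightarrow> 'a set)"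
  fix l assume l: "l \<in> clopen_partitions X"
  note lP = clopen_partitionsD[OF l]
  \<comment> \<open>The partition \<open>l\<close> itself is the cover to shadow by: its blocks are
    disjoint, so being shadowed means having the same itinerary in \<open>l\<close>.\<close>
  have "finite_open_cover X l"
    using l partition_onD1[OF lP] by (auto simp: finite_open_cover_def clopen_partitions_def)
  then obtain \<V> where \<V>: "finite_open_cover X \<V>"
    and shadow: "\<And>x. pseudo_orbit X f \<V> x \<Longrightarrow> \<exists>z\<in>orbits X f. shadows l z x"
    using assms unfolding shadowing_property_def by blast
  \<comment> \<open>Points in one block of \<open>m\<close> lie in a common member of
    \<open>\<V>\<close>.\<close>
  obtain m where m: "m \<in> clopen_partitions X"
    "\<And>x. x \<in> topspace X \<Longrightarrow> \<exists>U\<in>\<V>. \<forall>y\<in>topspace X. block m y = block m x \<longrightarrow> y \<in> U"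
  proof (rule directed_fibres_refine_cover[OF comp directed_clopen_partitions, of X block \<V>])
    fix P x assume P: "P \<in> clopen_partitions X" and x: "x \<in> topspace X"
    have "{y \<in> topspace X. block P y = block P x} = block P x"
      using in_block_iff[OF clopen_partitionsD[OF P] x] openin_subset[OF openin_block[OF P x]] by blast
    then show "openin X {y \<in> topspace X. block P y = block P x}"
      using openin_block[OF P x] by simp
  next
    show "block l y = block l x"
      if "coarser X l h" "x \<in> topspace X" "y \<in> topspace X" "block h y = block h x" for l h x y
      using coarsen_block[OF that(1)] that(2-) by metis
  next
    fix U x assume U: "openin X U" "x \<in> U"
    then have x: "x \<in> topspace X" using openin_subset by blast
    obtain P where P: "P \<in> clopen_partitions X" "block P x \<subseteq> U"
      using clopen_partition_base[OF comp haus td U] by blast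
    then show "\<exists>P\<in>clopen_partitions X. \<forall>y\<in>topspace X. block P y = block P x \<longrightarrow> y \<in> U"
      using in_block_iff[OF clopen_partitionsD[OF P(1)] x] by blast
  qed (use \<V> in \<open>auto simp: finite_open_cover_def\<close>)
  \<comment> \<open>\<open>c\<close> refines \<open>m\<close> so that its paths yield pseudo-orbits,
    and \<open>l\<close> so that they can be coarsened to \<open>l\<close>.\<close>
  obtain c where c: "c \<in> clopen_partitions X" "coarser X l c" "coarser X m c"
    using directed_clopen_partitions l m(1) unfolding directed_set_def by blast
  note cP = clopen_partitionsD[OF c(1)]
  have lifts: "?ind l c A \<in> ?ind l h ` ?orb h"
    if h: "h \<in> clopen_partitions X" "coarser X c h" and A: "A \<in> ?orb c" for h A
  proof -
    \<comment> \<open>\<open>x i\<close> witnesses the edge from \<open>A i\<close> to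
      \<open>A (Suc i)\<close>: some value of \<open>f\<close> at \<open>x i\<close> lies in
      \<open>A (Suc i)\<close>, though \<open>x (Suc i)\<close> need not be that value.\<close>
    have "\<exists>x. x \<in> A i \<and> (\<exists>y\<in>f x. block c y = A (Suc i))" for i
      using A unfolding orbits_def partition_map_def image_iff by fastforce
    then obtain x where x: "\<And>i. x i \<in> A i" "\<And>i. \<exists>y\<in>f (x i). block c y = A (Suc i)"
      by metis
    have Ac: "A i \<in> c" for i using A by (auto simp: orbits_def)
    have xX: "x i \<in> topspace X" for i using x(1) Ac partition_onD1[OF cP] by blast
    have bx: "block c (x i) = A i" for i using block_eqI[OF cP Ac x(1)] .
    have "pseudo_orbit X f \<V> x"
      unfolding pseudo_orbit_def
    proof (intro conjI allI)
      fix i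
      obtain U where U: "U \<in> \<V>"
        "\<And>y. y \<in> topspace X \<Longrightarrow> block m y = block m (x (Suc i)) \<Longrightarrow> y \<in> U"
        using m(2)[OF xX] by blast
      obtain y where y: "y \<in> f (x i)" "block c y = A (Suc i)" using x(2) by blast
      have yX: "y \<in> topspace X" using y(1) multivalued_map_subset xX by blast
      \<comment> \<open>The value \<open>y\<close> and the next point share the block
        \<open>A (Suc i)\<close> of \<open>c\<close>, hence a block of \<open>m\<close>, hence a
        member of \<open>\<V>\<close>.\<close>
      have "block m y = block m (x (Suc i))"
        using coarsen_block[OF c(3)] yX xX y(2) bx by metis
      with U y(1) yX xX show "\<exists>V\<in>\<V>. f (x i) \<inter> V \<noteq> {} \<and> x (Suc i) \<in> V" by blast
    qed (use xX in auto)
    then obtain z where z: "z \<in> orbits X f" "shadows l z x" using shadow by blast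
    have zX: "z i \<in> topspace X" and zf: "z (Suc i) \<in> f (z i)" for i
      using z(1) by (auto simp: orbits_def)
    note hP = clopen_partitionsD[OF h(1)]
    have lh: "coarser X l h" using refines_trans[OF h(2) c(2)] .
    \<comment> \<open>The itinerary in \<open>h\<close> of the shadowing orbit \<open>z\<close> is
      the lift sought.\<close>
    have "(\<lambda>i. block h (z i)) \<in> ?orb h"
      using block_in[OF hP zX] zf unfolding orbits_def partition_map_def by fastforce
    moreover have "coarsen l c (A i) = coarsen l h (block h (z i))" for i
    proof -
      obtain B where "B \<in> l" "x i \<in> B" "z i \<in> B" using z(2) by (auto simp: shadows_def)
      then have "block l (x i) = block l (z i)" using block_eqI[OF lP] by metis
      then show ?thesis
        using coarsen_block[OF c(2) xX, of i] coarsen_block[OF lh zX, of i] bx by simp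
    qed
    then have "?ind l c A = ?ind l h (\<lambda>i. block h (z i))" by (simp add: induced_orbit_map_def)
    ultimately show ?thesis by blast
  qed
  have "?ind l c ` ?orb c = ?ind l h ` ?orb h"
    if h: "h \<in> clopen_partitions X" "coarser X c h" for h
  proof
    \<comment> \<open>This inclusion is functoriality: coarsening from \<open>h\<close> to
      \<open>l\<close> passes through \<open>c\<close> and sends paths to paths.\<close>
    show "?ind l h ` ?orb h \<subseteq> ?ind l c ` ?orb c"
    proof
      fix B assume "B \<in> ?ind l h ` ?orb h"
      then obtain A where A: "A \<in> ?orb h" "B = ?ind l h A" by blast
      have "\<forall>A\<in>h. coarsen l h A = coarsen l c (coarsen c h A)"
        using partition_inverse_system l c h unfolding inverse_system_def by simp
      then have "?ind l h A = ?ind l c (?ind c h A)"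
        using A(1) by (auto simp: induced_orbit_map_def orbits_def)
      moreover have "?ind c h A \<in> ?orb c"
        by (rule induced_orbit_map_in_orbits[OF partition_inverse_system c(1) h A(1)])
      ultimately show "B \<in> ?ind l c ` ?orb c" using A(2) by blast
    qed
  qed (use lifts[OF h] in blast)
  with c show "\<exists>c\<in>clopen_partitions X. coarser X l c \<and> (\<forall>h\<in>clopen_partitions X.
      coarser X c h \<longrightarrow> ?ind l c ` ?orb c = ?ind l h ` ?orb h)" by blast
qed

text \<open>A point corresponds to the thread of its blocks. Clopen sets separate points,
  compactness puts a point behind every thread, and \<open>f x\<close> is recovered from the edges
  at all partitions because it is closed and \<open>f\<close> is upper semicontinuous.\<close>

lemma conjugate_partition_limit:
  "conjugate X f (inverse_limit_space (clopen_partitions X) (coarser X) discrete_topology coarsen)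
    (inverse_limit_map (clopen_partitions X) (coarser X) discrete_topology (partition_map f) coarsen)"
proof -
  let ?\<Lambda> = "clopen_partitions X"
  let ?L = "inverse_limit_space ?\<Lambda> (coarser X) discrete_topology coarsen"
  define p where "p x = (\<lambda>P\<in>?\<Lambda>. block P x)" for x
  have pL: "p x \<in> topspace ?L" if "x \<in> topspace X" for x
    using that by (auto simp: inverse_limit_space_def p_def coarsen_block
        intro: block_in dest: clopen_partitionsD)
  have cont: "continuous_map X ?L p"
  proof -
    have "continuous_map X (discrete_topology P) (\<lambda>x. p x P)" if P: "P \<in> ?\<Lambda>" for P
      unfolding continuous_map_def
    proof (intro conjI allI impI)
      note PP = clopen_partitionsD[OF P]
      show "(\<lambda>x. p x P) \<in> topspace X \<rightarrow> topspace (discrete_topology P)"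
        using P block_in(1)[OF PP] by (auto simp: p_def)
      fix U assume "openin (discrete_topology P) U"
      then have U: "U \<subseteq> P" by simp
      have "{x \<in> topspace X. p x P \<in> U} = \<Union>U"
        using P U block_in(2)[OF PP] block_eqI[OF PP] partition_onD1[OF PP]
        by (auto simp: p_def)
      also have "openin X \<dots>" using U P by (auto simp: clopen_partitions_def)
      finally show "openin X {x \<in> topspace X. p x P \<in> U}" .
    qed
    then have "continuous_map X (product_topology discrete_topology ?\<Lambda>) p"
      by (auto simp: continuous_map_componentwise p_def)
    then show ?thesis
      using pL unfolding inverse_limit_space_def by (auto simp: continuous_map_in_subtopology)
  qed
  have inj: "inj_on p (topspace X)"
  proof (rule inj_onI, rule ccontr)
    fix x y assume xy: "x \<in> topspace X" "y \<in> topspace X" "p x = p y" "x \<noteq> y"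
    then obtain U where U: "openin X U" "x \<in> U" "y \<notin> U"
      using haus unfolding Hausdorff_space_def by (metis disjnt_iff)
    obtain P where P: "P \<in> ?\<Lambda>" "block P x \<subseteq> U"
      using clopen_partition_base[OF comp haus td U(1,2)] by blast
    have "block P y = block P x" using fun_cong[OF xy(3), of P] P(1) by (simp add: p_def)
    then show False using block_in(2)[OF clopen_partitionsD[OF P(1)] xy(2)] P(2) U(3) by blast
  qed
  have surj: "p ` topspace X = topspace ?L"
  proof
    show "topspace ?L \<subseteq> p ` topspace X"
    proof
      fix y assume y: "y \<in> topspace ?L"
      have yin: "y P \<in> P" if "P \<in> ?\<Lambda>" for P
        using y that by (auto simp: inverse_limit_space_def PiE_iff)
      have yc: "y l = coarsen l h (y h)" if "l \<in> ?\<Lambda>" "h \<in> ?\<Lambda>" "coarser X l h" for l h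
        using y that by (auto simp: inverse_limit_space_def)
      \<comment> \<open>The blocks of a thread are nonempty closed sets that shrink under
        refinement; a point common to all of them is mapped by \<open>p\<close> to this
        thread.\<close>
      have "\<exists>x\<in>topspace X. \<forall>P\<in>?\<Lambda>. x \<in> y P"
      proof (rule compact_space_directed_Inter_nonempty[OF comp directed_clopen_partitions])
        fix P assume P: "P \<in> ?\<Lambda>"
        note PP = clopen_partitionsD[OF P]
        show "y P \<noteq> {}" using yin[OF P] partition_onD3[OF PP] by metis
        have "topspace X - y P = \<Union>(P - {y P})"
          using partition_onD1[OF PP] partition_onD2[OF PP] yin[OF P] by (auto dest: disjointD)
        also have "openin X \<dots>" using P by (auto simp: clopen_partitions_def)
        finally show "closedin X (y P)"
          using yin[OF P] partition_onD1[OF PP] by (auto simp: closedin_def)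
      next
        fix l h assume lh: "l \<in> ?\<Lambda>" "h \<in> ?\<Lambda>" "coarser X l h"
        note hP = clopen_partitionsD[OF lh(2)] and lP = clopen_partitionsD[OF lh(1)]
        show "y h \<subseteq> y l"
        proof
          fix x assume x: "x \<in> y h"
          then have xX: "x \<in> topspace X" using yin[OF lh(2)] partition_onD1[OF hP] by blast
          have "y h = block h x" using block_eqI[OF hP yin[OF lh(2)] x] by simp
          then have "y l = block l x" using yc[OF lh] coarsen_block[OF lh(3) xX] by simp
          then show "x \<in> y l" using block_in(2)[OF lP xX] by simp
        qed
      qed
      then obtain x where x: "x \<in> topspace X" "\<And>P. P \<in> ?\<Lambda> \<Longrightarrow> x \<in> y P" by blast
      have "p x = y"
      proof (rule extensionalityI[of _ ?\<Lambda>])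
        show "y \<in> extensional ?\<Lambda>" using y by (auto simp: inverse_limit_space_def PiE_iff)
        show "p x P = y P" if "P \<in> ?\<Lambda>" for P
          using block_eqI[OF clopen_partitionsD[OF that] yin[OF that] x(2)[OF that]] that
          by (simp add: p_def)
      qed (simp add: p_def)
      then show "y \<in> p ` topspace X" using x(1) by blast
    qed
  qed (use pL in auto)
  \<comment> \<open>A continuous bijection from a compact space onto a Hausdorff space is a
    homeomorphism, so continuity of the inverse need not be checked by hand.\<close>
  have "Hausdorff_space ?L"
    unfolding inverse_limit_space_def
    by (intro Hausdorff_space_subtopology) (simp add: Hausdorff_space_product_topology)
  then have hom: "homeomorphic_map X ?L p"
    using continuous_imp_homeomorphic_map[OF cont comp _ surj inj] by blast
  have "y \<in> f x \<longleftrightarrow> (\<forall>P\<in>?\<Lambda>. block P y \<in> partition_map f P (block P x))"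
    if x: "x \<in> topspace X" and y: "y \<in> topspace X" for x y
  proof
    assume "y \<in> f x"
    then show "\<forall>P\<in>?\<Lambda>. block P y \<in> partition_map f P (block P x)"
      using block_in(2)[OF clopen_partitionsD x] by (auto simp: partition_map_def)
  next
    \<comment> \<open>If \<open>y\<close> is outside \<open>f x\<close>, regularity separates them
      by \<open>U\<close> and \<open>W\<close>, and upper semicontinuity keeps the values of
      \<open>f\<close> on a neighbourhood \<open>N\<close> of \<open>x\<close> inside
      \<open>W\<close>. Once the block of \<open>x\<close> lies in \<open>N\<close> and that of
      \<open>y\<close> in \<open>U\<close>, no edge can join them.\<close>
    assume all: "\<forall>P\<in>?\<Lambda>. block P y \<in> partition_map f P (block P x)"
    show "y \<in> f x"
    proof (rule ccontr)
      assume "y \<notin> f x"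
      moreover have "closedin X (f x)" using mv x by (simp add: multivalued_map_def)
      ultimately obtain U W where UW: "openin X U" "openin X W" "y \<in> U" "f x \<subseteq> W" "disjnt U W"
        using compact_Hausdorff_imp_regular_space[OF comp haus] y unfolding regular_space_def
        by (metis DiffI)
      obtain N where N: "openin X N" "x \<in> N" "\<And>x'. x' \<in> N \<Longrightarrow> f x' \<subseteq> W"
        using mv x UW(2,4) unfolding multivalued_map_def by metis
      obtain P where P: "P \<in> ?\<Lambda>" "block P x \<subseteq> N"
        using clopen_partition_base[OF comp haus td N(1,2)] by blast
      obtain Q where Q: "Q \<in> ?\<Lambda>" "block Q y \<subseteq> U"
        using clopen_partition_base[OF comp haus td UW(1,3)] by blast
      obtain R where R: "R \<in> ?\<Lambda>" "coarser X P R" "coarser X Q R"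
        using directed_clopen_partitions P(1) Q(1) unfolding directed_set_def by blast
      note RP = clopen_partitionsD[OF R(1)]
      obtain x' y' where xy': "x' \<in> block R x" "y' \<in> f x'" "block R y' = block R y"
        using all R(1) unfolding partition_map_def by (metis (no_types, lifting) UN_E imageE)
      have x'X: "x' \<in> topspace X"
        using xy'(1) block_in(1)[OF RP x] partition_onD1[OF RP] by blast
      then have y'X: "y' \<in> topspace X" using xy'(2) multivalued_map_subset by blast
      have "block P x' = block P x" using block_coarser[OF R(2) x xy'(1)] .
      then have "x' \<in> N" using block_in(2)[OF clopen_partitionsD[OF P(1)] x'X] P(2) by auto
      moreover have "block Q y' = block Q y" using coarsen_block[OF R(3)] xy'(3) y y'X by metis
      then have "y' \<in> U" using block_in(2)[OF clopen_partitionsD[OF Q(1)] y'X] Q(2) by auto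
      ultimately show False using N(3) xy'(2) UW(5) by (auto simp: disjnt_iff)
    qed
  qed
  then have "f x = {z \<in> topspace X.
      p z \<in> inverse_limit_map ?\<Lambda> (coarser X) discrete_topology (partition_map f) coarsen (p x)}"
    if "x \<in> topspace X" for x
    using that multivalued_map_subset[OF that] pL by (auto simp: inverse_limit_map_def p_def)
  with hom show ?thesis unfolding conjugate_def by blast
qed

lemma shadowing_imp_conjugate_limit:
  assumes "shadowing_property X f"
  shows "conjugate_to_finite_type_limit X f (clopen_partitions X) (coarser X)
    discrete_topology (partition_map f) coarsen"
  unfolding conjugate_to_finite_type_limit_def
  by (intro conjI ballI partition_inverse_system finite_type_partition
      partition_orbits_mittag_leffler assms conjugate_partition_limit)

end

(* HOL cannot quantify existentially over types. The first conjunct is the equivalence, with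
   indices among the families of subsets of X and vertices among the subsets of X (large enough
   for the existence claim). The second conjunct gives the "if" direction for index and vertex
   sets in arbitrary types. *)
theorem theorem6p8:
  fixes X :: "'a topology" and f :: "'a \<Rightarrow> 'a set"
  assumes "compact_space X" and "Hausdorff_space X" and "totally_disconnected_space X"
    and "multivalued_map X f"
  shows "(shadowing_property X f \<longleftrightarrow>
            (\<exists>(\<Lambda> :: 'a set set set) le (V :: 'a set set \<Rightarrow> 'a set topology) fV g.
               conjugate_to_finite_type_limit X f \<Lambda> le V fV g)) \<and>
         (\<forall>(\<Lambda> :: 'i set) le (V :: 'i \<Rightarrow> 'v topology) fV g.
            conjugate_to_finite_type_limit X f \<Lambda> le V fV g \<longrightarrow> shadowing_property X f)"
proof (intro conjI iffI allI impI)
  show "\<exists>(\<Lambda> :: 'a set set set) le (V :: 'a set set \<Rightarrow> 'a set topology) fV g.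
      conjugate_to_finite_type_limit X f \<Lambda> le V fV g" if "shadowing_property X f"
    using shadowing_imp_conjugate_limit[OF assms that] by (intro exI)
  show "shadowing_property X f"
    if "\<exists>(\<Lambda> :: 'a set set set) le (V :: 'a set set \<Rightarrow> 'a set topology) fV g.
      conjugate_to_finite_type_limit X f \<Lambda> le V fV g"
    using that by (elim exE) (rule conjugate_to_finite_type_limit_imp_shadowing[OF assms(1)])
  show "shadowing_property X f" if "conjugate_to_finite_type_limit X f \<Lambda> le V fV g"
    for \<Lambda> :: "'i set" and le and V :: "'i \<Rightarrow> 'v topology" and fV g
    using that by (rule conjugate_to_finite_type_limit_imp_shadowing[OF assms(1)])
qed

end
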